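(* Let $p\ge 3$ be a prime, let $k$ be a positive integer, let $G$ be the set of monic polynomials of degree at most $2$ in $\mathbb{F}_p[X]$, let $U_G$ be a random variable uniformly distributed in $G$, and let $A:=S_k(U_G)$. Let $U_k$ be uniformly distributed on $\{0,1\}^k$. Then $$\Delta(A,U_k)\ll\sqrt{\frac{2^{k}}{p}}\left(1+\frac{\sqrt{\log_2(p)}}{p+1}\right),$$ where the implied constant is absolute.
   Context: Statistical distance: for random variables $X,Y$ with values in a finite set $\mathcal{X}$, $\Delta(X,Y)=\frac12\sum_{x\in\mathcal{X}}|\Pr[X=x]-\Pr[Y=x]|$. For $x\in\mathbb{F}_p$, identified with its representative in $\{0,1,\dots,p-1\}$, $\mathrm{lsb}_k(x)\in\{0,1\}^k$ denotes the $k$ least significant bits of $x$. The elements of $G$ are the possible first components $u$ of Mumford representations $[u,v]$ of reduced divisors on a genus $2$ hyperelliptic curve over $\mathbb{F}_p$. The extractor $S_k:G\to\{0,1\}^k$ depends only on this first component and is defined by $S_k(X^2+u_1X+u_0)=\mathrm{lsb}_k(-u_1)$, $S_k(X+u_0)=\mathrm{lsb}_k(-u_0)$, and $S_k(1)=0$ (the zero string). *)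

theory Defs
  imports
    "HOL-Probability.Probability"
    "HOL-Number_Theory.Residues"
    "HOL-Algebra.Polynomials"
begin

definition stat_dist :: "'a set \<Rightarrow> 'a pmf \<Rightarrow> 'a pmf \<Rightarrow> real" where
  "stat_dist S P Q = (1 / 2) * (\<Sum>x\<in>S. \<bar>pmf P x - pmf Q x\<bar>)"

definition bit_strings :: "nat \<Rightarrow> bool list set" where
  "bit_strings k = {xs. length xs = k}"

(* Elements of residue_ring (int p) are the integers 0, ..., p - 1 themselves, so no choice of
   representative is needed.  Entry i of the string is the coefficient of 2^i. *)
definition lsb :: "nat \<Rightarrow> int \<Rightarrow> bool list" where
  "lsb k x = map (bit x) [0..<k]"

(* The prime field as a ring record with an explicit carrier, rather than as a type: p has to be
   quantified inside the scope of an absolute constant. *)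
abbreviation prime_field :: "nat \<Rightarrow> int ring" where
  "prime_field p \<equiv> residue_ring (int p)"

(* HOL-Algebra polynomials are coefficient lists, leading (nonzero) coefficient first; [] is the
   zero polynomial. *)
definition monic_deg_le2 :: "nat \<Rightarrow> int list set" where
  "monic_deg_le2 p =
    {f \<in> carrier (univ_poly (prime_field p) (carrier (prime_field p))).
       f \<noteq> [] \<and> lead_coeff f = \<one>\<^bsub>prime_field p\<^esub> \<and> Polynomials.degree f \<le> 2}"

(* In the first two equations the first list entry is the leading coefficient, which is 1 on
   monic_deg_le2 p.  There the last equation concerns only the constant polynomial 1. *)
fun extractor :: "nat \<Rightarrow> nat \<Rightarrow> int list \<Rightarrow> bool list" where
  "extractor p k [_, u1, u0] = lsb k (\<ominus>\<^bsub>prime_field p\<^esub> u1)"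
| "extractor p k [_, u0] = lsb k (\<ominus>\<^bsub>prime_field p\<^esub> u0)"
| "extractor p k _ = replicate k False"

end

theory Submission
  imports Defs
begin

text \<open>
  Since negation permutes the residues, exactly \<open>N (p + 1)\<close> elements of \<open>G\<close> of positive degree are
  mapped to a given string \<open>x\<close>, where \<open>N\<close> counts the residues below \<open>p\<close> whose low bits are \<open>x\<close>.
  As \<open>2 ^ k * N\<close> differs from \<open>p\<close> by at most \<open>2 ^ k\<close>, each probability is within \<open>2 / p\<close> of
  \<open>1 / 2 ^ k\<close>, and the distance is at most \<open>2 ^ k / p\<close>. It is also at most 1, hence at
  most \<open>sqrt (2 ^ k / p)\<close> in all cases, so \<open>C = 1\<close> works.
\<close>

text \<open>Half the sum of two masses, each at most 1. This covers the case
  \<open>2 ^ k > p\<close>, where the bound \<open>2 ^ k / p\<close> exceeds 1.\<close>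

lemma stat_dist_le_1:
  assumes "finite S"
  shows "stat_dist S P Q \<le> 1"
proof -
  have mass: "(\<Sum>x\<in>S. pmf R x) \<le> 1" for R
    using assms by (simp flip: measure_measure_pmf_finite)
  have "(\<Sum>x\<in>S. \<bar>pmf P x - pmf Q x\<bar>) \<le> (\<Sum>x\<in>S. pmf P x + pmf Q x)"
  proof (rule sum_mono)
    fix x show "\<bar>pmf P x - pmf Q x\<bar> \<le> pmf P x + pmf Q x"
      using pmf_nonneg[of P x] pmf_nonneg[of Q x] by linarith
  qed
  then show ?thesis
    using mass[of P] mass[of Q] by (simp add: stat_dist_def sum.distrib)
qed

section \<open>Bit strings and residues with prescribed low bits\<close>

lemma finite_bit_strings: "finite (bit_strings k)"
  and card_bit_strings: "card (bit_strings k) = 2 ^ k"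
  using finite_lists_length_eq[of "UNIV :: bool set" k]
    card_lists_length_eq[of "UNIV :: bool set" k]
  by (simp_all add: bit_strings_def card_UNIV_bool)

text \<open>The Horner sum is the integer with binary digits \<open>x\<close>, least significant
  first, so prescribing the low bits of \<open>r\<close> means fixing a residue class modulo
  \<open>2 ^ k\<close>.\<close>

lemma lsb_eq_iff:
  assumes "length x = k"
  shows "lsb k r = x \<longleftrightarrow> r mod 2 ^ k = horner_sum of_bool 2 x"
proof
  assume "lsb k r = x"
  then show "r mod 2 ^ k = horner_sum of_bool 2 x"
    unfolding lsb_def by (metis horner_sum_bit_eq_take_bit take_bit_eq_mod)
next
  assume *: "r mod 2 ^ k = horner_sum of_bool 2 x"
  have "bit r i = x ! i" if "i < k" for i
  proof -
    have "bit (take_bit k r) i = bit (horner_sum of_bool (2::int) x) i"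
      using * by (simp add: take_bit_eq_mod)
    then show ?thesis
      using that assms by (simp add: bit_take_bit_iff bit_horner_sum_bit_iff)
  qed
  then show "lsb k r = x"
    using assms by (auto simp: lsb_def intro: nth_equalityI)
qed

text \<open>The set is the progression v, v + m, ... cut off below n. Its length J satisfies n - v
  \<le> m * J \<le> n - v + m - 1, and 0 \<le> v < m puts both ends within m of n.\<close>

lemma card_residue_class:
  fixes n m v :: int
  assumes "n \<ge> 0" "0 \<le> v" "v < m"
  shows "\<bar>m * int (card {r \<in> {0..<n}. r mod m = v}) - n\<bar> \<le> m"
proof -
  \<comment> \<open>This is (n - v) / m rounded up. It is nonnegative even if n < v, because v <
    m.\<close>
  define J where "J = (n - v + m - 1) div m"
  have m: "m > 0" using assms by linarith
  have J: "m * J \<le> n - v + m - 1" "n - v + m - 1 < m * J + m"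
    using m mult_div_mod_eq[of m "n - v + m - 1"] pos_mod_bound[of m "n - v + m - 1"]
      pos_mod_sign[of m "n - v + m - 1"]
    unfolding J_def by linarith+
  have "J \<ge> 0" unfolding J_def using assms m by (simp add: pos_imp_zdiv_nonneg_iff)
  have "{r \<in> {0..<n}. r mod m = v} = (\<lambda>j. v + m * j) ` {0..<J}"
  proof (intro equalityI subsetI)
    fix r assume r: "r \<in> {r \<in> {0..<n}. r mod m = v}"
    then have eq: "r = v + m * (r div m)"
      using mult_div_mod_eq[of m r] by auto
    have "r < v + m * J" using r J by auto
    then have "m * (r div m) < m * J" using eq by linarith
    then have "r div m < J" using m by simp
    moreover have "r div m \<ge> 0" using r m by (simp add: pos_imp_zdiv_nonneg_iff)
    ultimately show "r \<in> (\<lambda>j. v + m * j) ` {0..<J}" using eq by auto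
  next
    fix r assume "r \<in> (\<lambda>j. v + m * j) ` {0..<J}"
    then obtain j where j: "r = v + m * j" "j \<in> {0..<J}" by blast
    then have "0 \<le> j" "j \<le> J - 1" by auto
    note j = j(1) this
    \<comment> \<open>The last term v + m * (J - 1) is at most n - 1 by the first bound in
      \<open>J\<close>.\<close>
    have "m * j \<le> m * (J - 1)" using j m by (intro mult_left_mono) auto
    then have "r < n" using j J by (simp add: algebra_simps)
    then show "r \<in> {r \<in> {0..<n}. r mod m = v}" using j m assms by auto
  qed
  moreover have "inj_on (\<lambda>j. v + m * j) {0..<J}" using m by (auto simp: inj_on_def)
  ultimately have "card {r \<in> {0..<n}. r mod m = v} = nat J" by (simp add: card_image)
  then show ?thesis using J \<open>J \<ge> 0\<close> assms by simp
qed

lemma card_lsb: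
  assumes "length x = k"
  shows "\<bar>2 ^ k * int (card {r \<in> {0..<int p}. lsb k r = x}) - int p\<bar> \<le> 2 ^ k"
proof -
  \<comment> \<open>A Horner sum over k bits is unchanged by truncation to k bits. This yields the
    range 0 \<le> v < \<open>2 ^ k\<close> that \<open>card_residue_class\<close> requires.\<close>
  have "horner_sum of_bool 2 x = (take_bit k (horner_sum of_bool 2 x) :: int)"
    by (rule bit_eqI) (use assms in \<open>auto simp: bit_take_bit_iff bit_horner_sum_bit_iff\<close>)
  then have "0 \<le> (horner_sum of_bool 2 x :: int)" "(horner_sum of_bool 2 x :: int) < 2 ^ k"
    by (metis take_bit_nonnegative, metis take_bit_int_less_exp)
  then show ?thesis
    unfolding lsb_eq_iff[OF assms]
    by (intro card_residue_class) auto
qed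

lemma card_lsb_uminus:
  assumes "p > 1"
  shows "card {r \<in> {0..<int p}. lsb k (\<ominus>\<^bsub>prime_field p\<^esub> r) = x}
    = card {r \<in> {0..<int p}. lsb k r = x}"
proof -
  interpret residues "int p" "prime_field p"
    using assms by unfold_locales auto
  have "bij_betw (\<lambda>r. - r mod int p) {r \<in> {0..<int p}. lsb k (\<ominus>\<^bsub>prime_field p\<^esub> r) = x}
    {r \<in> {0..<int p}. lsb k r = x}"
    \<comment> \<open>Negation modulo p is an involution, so it serves as its own inverse.\<close>
    by (rule bij_betw_byWitness[where f' = "\<lambda>r. - r mod int p"])
      (use assms in \<open>auto simp: res_neg_eq mod_minus_eq\<close>)
  then show ?thesis by (rule bij_betw_same_card)
qed

section \<open>Counting monic polynomials and the fibres of the extractor\<close>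

lemma monic_deg_le2_eq:
  assumes "p > 1"
  shows "monic_deg_le2 p = {[1]} \<union> (\<lambda>a. [1, a]) ` {0..<int p}
    \<union> (\<lambda>(a, b). [1, a, b]) ` ({0..<int p} \<times> {0..<int p})"
proof -
  interpret residues "int p" "prime_field p"
    using assms by unfold_locales auto
  \<comment> \<open>The degree is \<open>length f - 1\<close> with truncated subtraction, so the
    empty list has to be excluded separately.\<close>
  have len: "f \<noteq> [] \<and> length f - 1 \<le> 2 \<longleftrightarrow>
      (\<exists>c. f = [c]) \<or> (\<exists>c a. f = [c, a]) \<or> (\<exists>c a b. f = [c, a, b])" for f :: "int list"
    by (cases f rule: remdups_adj.cases) (auto simp: le_Suc_eq length_Suc_conv numeral_2_eq_2)
  have "monic_deg_le2 p
      = {f. set f \<subseteq> {0..<int p} \<and> hd f = 1 \<and> f \<noteq> [] \<and> length f - 1 \<le> 2}"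
    by (auto simp: monic_deg_le2_def univ_poly_carrier[symmetric] polynomial_def
        res_carrier_eq res_one_eq res_zero_eq)
  also have "\<dots> = {f. set f \<subseteq> {0..<int p} \<and> hd f = 1 \<and>
      ((\<exists>c. f = [c]) \<or> (\<exists>c a. f = [c, a]) \<or> (\<exists>c a b. f = [c, a, b]))}"
    unfolding len ..
  also have "\<dots> = {[1]} \<union> (\<lambda>a. [1, a]) ` {0..<int p}
    \<union> (\<lambda>(a, b). [1, a, b]) ` ({0..<int p} \<times> {0..<int p})"
    using assms by (auto simp: image_iff)
  finally show ?thesis .
qed

text \<open>With N admissible values of the coefficient that is read, there are N linear polynomials
  and N * p quadratic ones, whose constant term is free. The constant polynomial 1 adds one element
  to the fibre of the zero string.\<close>

lemma card_extractor_fibre: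
  assumes "p > 1"
  shows "card {f \<in> monic_deg_le2 p. extractor p k f = x}
    = card {r \<in> {0..<int p}. lsb k r = x} * (p + 1) + of_bool (x = replicate k False)"
proof -
  let ?N = "{r \<in> {0..<int p}. lsb k (\<ominus>\<^bsub>prime_field p\<^esub> r) = x}"
  let ?Z = "{f. f = [1::int] \<and> x = replicate k False}"
  let ?L = "(\<lambda>a. [1, a]) ` ?N"
  let ?Q = "(\<lambda>(a, b). [1, a, b]) ` (?N \<times> {0..<int p})"
  have fibre: "{f \<in> monic_deg_le2 p. extractor p k f = x} = ?Z \<union> ?L \<union> ?Q"
    unfolding monic_deg_le2_eq[OF assms] by auto
  have "card (?Z \<union> ?L \<union> ?Q) = card ?Z + card ?L + card ?Q"
  proof -
    have "finite ?N" by (rule finite_subset[of _ "{0..<int p}"]) auto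
    then have fin: "finite ?Z" "finite ?L" "finite ?Q"
      by (simp_all only: finite_imageI finite_cartesian_product finite_atLeastLessThan_int) simp
    have disjoint: "?Z \<inter> ?L = {}" "(?Z \<union> ?L) \<inter> ?Q = {}" by auto
    have "card (?Z \<union> ?L \<union> ?Q) = card (?Z \<union> ?L) + card ?Q"
      using fin disjoint(2) by (intro card_Un_disjoint finite_UnI)
    also have "card (?Z \<union> ?L) = card ?Z + card ?L"
      using fin disjoint(1) by (intro card_Un_disjoint)
    finally show ?thesis .
  qed
  moreover have "card ?Z = of_bool (x = replicate k False)"
    by (cases "x = replicate k False") simp_all
  moreover have "card ?L = card ?N"
    by (rule card_image) (simp add: inj_on_def)
  moreover have "card ?Q = card ?N * card {0..<int p}"
    unfolding card_cartesian_product[symmetric]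
    by (rule card_image) (simp add: inj_on_def split_beta prod_eq_iff)
  ultimately show ?thesis
    unfolding fibre card_lsb_uminus[OF assms] by simp
qed

text \<open>For k = 0 the whole set is the fibre of the empty string and every residue is
  admissible, so the fibre count gives p * (p + 1) + 1.\<close>

lemma card_monic_deg_le2:
  assumes "p > 1"
  shows "card (monic_deg_le2 p) = p\<^sup>2 + p + 1"
proof -
  have "extractor p 0 f = []" for f
    by (induction p "0::nat" f rule: extractor.induct) (auto simp: lsb_def)
  then show ?thesis
    using card_extractor_fibre[OF assms, of 0 "[]"]
    by (simp add: lsb_def power2_eq_square flip: atLeastLessThan_iff)
qed

section \<open>Probabilities and statistical distance\<close>

lemma pmf_extractor:
  assumes "p > 1"
  shows "pmf (map_pmf (extractor p k) (pmf_of_set (monic_deg_le2 p))) x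
    = (real (card {r \<in> {0..<int p}. lsb k r = x}) * (real p + 1) + of_bool (x = replicate k False))
      / ((real p)\<^sup>2 + real p + 1)"
proof -
  have "finite (monic_deg_le2 p)" "monic_deg_le2 p \<noteq> {}"
    unfolding monic_deg_le2_eq[OF assms] by auto
  then have "pmf (map_pmf (extractor p k) (pmf_of_set (monic_deg_le2 p))) x
      = real (card {f \<in> monic_deg_le2 p. extractor p k f = x}) / real (card (monic_deg_le2 p))"
    by (simp add: pmf_map measure_pmf_of_set vimage_def Int_def)
  then show ?thesis
    by (simp add: card_extractor_fibre[OF assms] card_monic_deg_le2[OF assms] algebra_simps)
qed

lemma pmf_extractor_approx:
  assumes "p > 1" "length x = k"
  shows "\<bar>pmf (map_pmf (extractor p k) (pmf_of_set (monic_deg_le2 p))) x - 1 / 2 ^ k\<bar> \<le> 2 / real p"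
proof -
  define N where "N = real (card {r \<in> {0..<int p}. lsb k r = x})"
  define \<delta> :: real where "\<delta> = of_bool (x = replicate k False)"
  define m :: real where "m = 2 ^ k"
  define q where "q = real p"
  define D where "D = q\<^sup>2 + q + 1"
  have q: "q > 1" using assms by (simp add: q_def)
  have m: "m \<ge> 1" by (simp add: m_def)
  have D: "D > 0" using q by (simp add: D_def add_pos_nonneg)
  have "real_of_int \<bar>2 ^ k * int (card {r \<in> {0..<int p}. lsb k r = x}) - int p\<bar> \<le> real_of_int (2 ^ k)"
    using card_lsb[OF assms(2), of p] by (rule of_int_le_iff[THEN iffD2])
  then have N: "\<bar>m * N - q\<bar> \<le> m" by (simp add: m_def N_def q_def)
  \<comment> \<open>Writing D as q * (q + 1) + 1 pairs \<open>m * N\<close> with q, and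
    \<open>m * \<delta>\<close> with 1.\<close>
  have "\<bar>(N * (q + 1) + \<delta>) / D - 1 / m\<bar> = \<bar>(m * N - q) * (q + 1) + (m * \<delta> - 1)\<bar> / (m * D)"
  proof -
    have "(N * (q + 1) + \<delta>) / D - 1 / m = ((m * N - q) * (q + 1) + (m * \<delta> - 1)) / (m * D)"
      using m D by (simp add: field_simps) (simp add: D_def power2_eq_square algebra_simps)
    then show ?thesis using m D by (simp add: abs_divide)
  qed
  also have "\<dots> \<le> (m * (q + 1) + m) / (m * D)"
  proof (rule divide_right_mono)
    have "\<bar>(m * N - q) * (q + 1)\<bar> \<le> m * (q + 1)"
      using mult_right_mono[OF N, of "q + 1"] q by (simp add: abs_mult)
    moreover have "\<bar>m * \<delta> - 1\<bar> \<le> m" using m by (auto simp: \<delta>_def)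
    ultimately show "\<bar>(m * N - q) * (q + 1) + (m * \<delta> - 1)\<bar> \<le> m * (q + 1) + m" by linarith
  qed (use m D in auto)
  also have "\<dots> = (q + 2) / D" using m D by (simp add: divide_simps) (simp add: algebra_simps)
  \<comment> \<open>Cross-multiplied, this is q * (q + 2) \<le> 2 * D.\<close>
  also have "\<dots> \<le> 2 / q"
    using q D by (simp add: divide_simps) (simp add: D_def power2_eq_square algebra_simps)
  finally show ?thesis
    by (simp add: pmf_extractor[OF assms(1)] N_def \<delta>_def m_def q_def D_def)
qed

lemma stat_dist_extractor_le:
  assumes "p > 1"
  shows "stat_dist (bit_strings k) (map_pmf (extractor p k) (pmf_of_set (monic_deg_le2 p)))
    (pmf_of_set (bit_strings k)) \<le> 2 ^ k / real p"
proof -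
  let ?P = "map_pmf (extractor p k) (pmf_of_set (monic_deg_le2 p))"
  let ?U = "pmf_of_set (bit_strings k)"
  have "bit_strings k \<noteq> {}" using card_bit_strings[of k] by auto
  then have U: "pmf ?U x = 1 / 2 ^ k" if "x \<in> bit_strings k" for x
    using that by (simp add: finite_bit_strings card_bit_strings)
  have "(\<Sum>x\<in>bit_strings k. \<bar>pmf ?P x - pmf ?U x\<bar>) \<le> real (card (bit_strings k)) * (2 / real p)"
  proof (rule sum_bounded_above)
    fix x assume "x \<in> bit_strings k"
    then show "\<bar>pmf ?P x - pmf ?U x\<bar> \<le> 2 / real p"
      using pmf_extractor_approx[OF assms, of x k] U by (simp add: bit_strings_def)
  qed
  \<comment> \<open>The factor 1/2 in \<open>stat_dist\<close> cancels the 2 in the pointwise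
    error.\<close>
  then show ?thesis by (simp add: stat_dist_def card_bit_strings)
qed

theorem lemma19:
  shows "\<exists>C::real. \<forall>p k :: nat. Factorial_Ring.prime p \<longrightarrow> p \<ge> 3 \<longrightarrow> k > 0 \<longrightarrow>
    stat_dist (bit_strings k)
      (map_pmf (extractor p k) (pmf_of_set (monic_deg_le2 p)))
      (pmf_of_set (bit_strings k))
    \<le> C * (sqrt (2 ^ k / real p) * (1 + sqrt (log 2 (real p)) / (real p + 1)))"
proof (intro exI[of _ 1] allI impI)
  fix p k :: nat
  assume p: "p \<ge> 3"
  let ?d = "stat_dist (bit_strings k) (map_pmf (extractor p k) (pmf_of_set (monic_deg_le2 p)))
    (pmf_of_set (bit_strings k))"
  let ?t = "2 ^ k / real p"
  have t: "?t \<ge> 0" by simp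
  \<comment> \<open>The square root of t lies between t and 1, so it is at least the smaller of
    them.\<close>
  have "min 1 ?t \<le> sqrt ?t"
  proof (cases "?t \<le> 1")
    case True
    then have "?t\<^sup>2 \<le> ?t"
      using mult_left_le[OF True t] by (simp only: power2_eq_square)
    then have "?t \<le> sqrt ?t" by (rule real_le_rsqrt)
    then show ?thesis by linarith
  next
    case False
    then have "1 \<le> sqrt ?t" by (simp del: real_sqrt_divide)
    then show ?thesis by linarith
  qed
  moreover have "?d \<le> min 1 ?t"
    using stat_dist_le_1[OF finite_bit_strings] stat_dist_extractor_le[of p k] p by simp
  \<comment> \<open>The logarithm is nonnegative for p \<ge> 3, so the bracket is at least 1 and the
    bound by \<open>sqrt ?t\<close> suffices.\<close>
  moreover have "sqrt ?t * 1 \<le> sqrt ?t * (1 + sqrt (log 2 (real p)) / (real p + 1))"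
    using p by (intro mult_left_mono) auto
  ultimately show "?d \<le> 1 * (sqrt ?t * (1 + sqrt (log 2 (real p)) / (real p + 1)))"
    by linarith
qed

end
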